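(* There exist an odd positive integer $M$ and an integer $\alpha$ such that the residue class $\{x\in\mathbb{Z}:\ x\equiv\alpha\pmod{M}\}$ contains no integer of the form $p^2+b^2+2^n$ with $p$ prime and $b,n\in\mathbb{N}$.
   Context: $\mathbb{N}=\{0,1,2,\ldots\}$. *)

theory Defs
  imports "HOL-Number_Theory.Number_Theory"
begin

end

theory Submission
  imports Defs
begin

text \<open>
  A prime \<open>q \<equiv> 3 (mod 4)\<close> dividing \<open>p\<^sup>2 + b\<^sup>2\<close> divides both \<open>p\<close> and \<open>b\<close>, so \<open>p = q\<close> if \<open>p\<close> is prime.
  Choose finitely many classes \<open>n \<equiv> a (mod m)\<close> that cover all exponents, together with distinct
  primes \<open>q \<equiv> 3 (mod 4)\<close> such that \<open>q\<close> divides \<open>2\<^sup>m - 1\<close>, and require \<open>x \<equiv> 2\<^sup>a (mod q)\<close>. Then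
  \<open>x = p\<^sup>2 + b\<^sup>2 + 2\<^sup>n\<close> forces \<open>p\<close> to be one of the finitely many primes \<open>q\<close>. Each of these is
  excluded by a further prime \<open>r \<equiv> 3 (mod 4)\<close> modulo which 2 is a square: if \<open>x \<equiv> q\<^sup>2 (mod r)\<close>,
  then \<open>x - q\<^sup>2 - 2\<^sup>n \<equiv> - 2\<^sup>n\<close> is not a square modulo \<open>r\<close>.
\<close>

section \<open>Primes congruent to 3 modulo 4\<close>

text \<open>Otherwise \<open>q\<close> divides neither \<open>a\<close> nor \<open>b\<close>.
  Raising a^2 = -b^2 to the power (q - 1) / 2, which is odd, and applying Fermat gives 1 = -1 modulo
  \<open>q\<close>.\<close>

lemma prime_3_mod_4_dvd_sum_squares:
  fixes a b :: int and q :: nat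
  assumes q: "prime q" "q mod 4 = 3" and dvd: "int q dvd a\<^sup>2 + b\<^sup>2"
  shows "int q dvd a"
proof (rule ccontr)
  assume na: "\<not> int q dvd a"
  have pq: "prime (int q)" using q by simp
  have nb: "\<not> int q dvd b"
  proof
    assume "int q dvd b"
    then have "int q dvd b\<^sup>2" by (simp add: power2_eq_square)
    with dvd have "int q dvd a\<^sup>2" using dvd_add_left_iff by blast
    with na pq show False using prime_dvd_power by blast
  qed
  define k where "k = (q - 1) div 2"
  have k: "q - 1 = 2 * k" "odd k" unfolding k_def using q(2) by presburger+
  have fermat: "[c ^ (q - 1) = 1] (mod int q)" if "\<not> int q dvd c" for c :: int
  proof -
    have "\<not> q dvd nat \<bar>c\<bar>"
      using that by (metis abs_ge_zero dvd_abs_iff int_dvd_int_iff int_nat_eq)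
    then have "[nat \<bar>c\<bar> ^ (q - 1) = 1] (mod q)"
      using fermat_theorem q(1) by blast
    then have "[\<bar>c\<bar> ^ (q - 1) = 1] (mod int q)"
      by (metis abs_ge_zero cong_int_iff int_nat_eq of_nat_1 of_nat_power)
    then show ?thesis using k by (simp add: power_even_abs)
  qed
  have "[a\<^sup>2 = - (b\<^sup>2)] (mod int q)"
    using dvd by (simp add: cong_iff_dvd_diff)
  then have "[(a\<^sup>2) ^ k = (- (b\<^sup>2)) ^ k] (mod int q)"
    by (rule cong_pow)
  then have "[a ^ (q - 1) = - (b ^ (q - 1))] (mod int q)"
    using k by (simp add: power_mult [symmetric])
  then have "[1 = - 1] (mod int q)"
    using fermat[OF na] cong_minus_minus_iff fermat[OF nb] by (meson cong_sym cong_trans)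
  then have "int q dvd 2" by (simp add: cong_iff_dvd_diff)
  then have "q \<le> 2" using zdvd_imp_le by force
  with q(2) show False by (cases "q \<le> 2") (auto simp: le_Suc_eq numeral_2_eq_2)
qed

text \<open>An odd number whose prime factors are all 1 modulo 4 is itself 1 modulo 4; the induction
  divides out such factors one at a time.\<close>

lemma ex_prime_factor_3_mod_4:
  fixes n :: nat
  assumes "n mod 4 = 3"
  shows "\<exists>q. prime q \<and> q dvd n \<and> q mod 4 = 3"
  using assms
proof (induction n rule: less_induct)
  case (less n)
  from less.prems have "n \<noteq> 1" by auto
  then obtain p where p: "prime p" "p dvd n" using prime_factor_nat by blast
  show ?case
  proof (cases "p mod 4 = 3")
    case True
    with p show ?thesis by blast
  next
    case False
    from p(2) obtain k where k: "n = p * k" by blast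
    have "odd n" using less.prems by presburger
    then have "odd p" using k by simp
    with False have "p mod 4 = 1" by presburger
    then have "k mod 4 = 3"
      using less.prems k mod_mult_left_eq[of p 4 k] by simp
    moreover have "k < n"
    proof -
      have "k > 0" using k less.prems by (cases "k = 0") auto
      then show ?thesis using k prime_gt_1_nat[OF p(1)] by simp
    qed
    ultimately obtain q where "prime q" "q dvd k" "q mod 4 = 3" using less.IH by blast
    with k show ?thesis by (auto intro: dvd_mult)
  qed
qed

section \<open>Excluding a finite set of primes\<close>

text \<open>Supplies fresh primes modulo which 2 is a square: the congruence makes \<open>m\<close>
  the inverse of a square root of 2.\<close>

lemma ex_coprime_prime_3_mod_4:
  fixes D :: nat
  assumes "D > 0"
  shows "\<exists>r m. prime r \<and> r mod 4 = 3 \<and> coprime r D \<and> [2 * m\<^sup>2 = 1] (mod int r)"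
proof -
  \<comment> \<open>The factor 2 gives N = 3 (mod 4); the factor \<open>D\<close> gives N = -1
    modulo every divisor of \<open>D\<close>, so the prime found is new.\<close>
  define m where "m = 2 * D"
  define N where "N = 2 * m\<^sup>2 - 1"
  have N1: "N + 1 = 2 * m\<^sup>2" unfolding N_def m_def using assms by simp
  have "N + 1 = 4 * (2 * D\<^sup>2)" unfolding N1 m_def by (simp add: power2_eq_square)
  then have "N mod 4 = 3" by presburger
  then obtain r where r: "prime r" "r dvd N" "r mod 4 = 3"
    using ex_prime_factor_3_mod_4 by blast
  have "\<not> r dvd D"
  proof
    assume "r dvd D"
    then have "r dvd N + 1" unfolding N1 m_def by (simp add: power2_eq_square)
    with r(2) have "r dvd 1" using dvd_add_right_iff by blast
    with r(1) show False by simp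
  qed
  then have "coprime r D" using r(1) prime_imp_coprime by blast
  moreover have "[2 * (int m)\<^sup>2 = 1] (mod int r)"
  proof -
    have "int N = 2 * (int m)\<^sup>2 - 1"
      using N1 by (metis add_diff_cancel_right' int_ops(2) of_nat_add of_nat_mult of_nat_numeral of_nat_power)
    then show ?thesis using r(2) by (metis cong_iff_dvd_diff int_dvd_int_iff)
  qed
  ultimately show ?thesis using r by blast
qed

text \<open>As 2 is a square modulo \<open>r\<close>, so is \<open>2 ^ n\<close>; a sum of two
  squares divisible by \<open>r\<close> would then make \<open>r\<close> divide a power of
  2.\<close>

lemma not_dvd_square_plus_power_two:
  fixes c m :: int and r n :: nat
  assumes r: "prime r" "r mod 4 = 3" and m: "[2 * m\<^sup>2 = 1] (mod int r)"
  shows "\<not> int r dvd c\<^sup>2 + 2 ^ n"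
proof
  assume dvd: "int r dvd c\<^sup>2 + 2 ^ n"
  have pr: "prime (int r)" using r by simp
  have not_dvd: "\<not> int r dvd 2 ^ k" for k
  proof
    assume "int r dvd 2 ^ k"
    then have "int r dvd 2" using pr prime_dvd_power by blast
    then have "r \<le> 2" using zdvd_imp_le by force
    with r(2) show False by (cases "r \<le> 2") (auto simp: le_Suc_eq numeral_2_eq_2)
  qed
  show False
  proof (cases "even n")
    case True
    then obtain k where "n = 2 * k" by blast
    then have "int r dvd (2 ^ k)\<^sup>2 + c\<^sup>2"
      using dvd by (simp add: power_mult [symmetric] mult.commute add.commute)
    from prime_3_mod_4_dvd_sum_squares[OF r this] show False using not_dvd by blast
  next
    case False
    then obtain k where k: "n = 2 * k + 1" using oddE by blast
    have r_dvd: "int r dvd (2 * m\<^sup>2 - 1) * (2 ^ k)\<^sup>2"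
      using m by (simp add: cong_iff_dvd_diff)
    \<comment> \<open>Multiplying by m^2 turns the surplus factor 2 of \<open>2 ^ n\<close> into 1
      modulo \<open>r\<close>.\<close>
    have "int r dvd m\<^sup>2 * (c\<^sup>2 + 2 ^ n)" using dvd by simp
    also have "(2::int) ^ n = 2 * (2 ^ k)\<^sup>2"
      unfolding k by (simp add: power_even_eq)
    also have "m\<^sup>2 * (c\<^sup>2 + 2 * (2 ^ k)\<^sup>2) = (2 ^ k)\<^sup>2 + (m * c)\<^sup>2 + (2 * m\<^sup>2 - 1) * (2 ^ k)\<^sup>2"
      by (simp only: power_mult_distrib ring_distribs mult_1_left mult_ac add_ac)
    finally have "int r dvd (2 ^ k)\<^sup>2 + (m * c)\<^sup>2"
      by (simp only: dvd_add_left_iff[OF r_dvd])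
    from prime_3_mod_4_dvd_sum_squares[OF r this] show False using not_dvd by blast
  qed
qed

text \<open>Each new \<open>q\<close> in \<open>P\<close> receives a prime \<open>r\<close> coprime
  to the modulus built so far, and the Chinese remainder theorem imposes x = q^2 (mod r). The class
  modulo \<open>D\<close> is only refined, so its properties survive.\<close>

lemma ex_residue_class_avoiding_squares:
  fixes P :: "int set" and D \<alpha> :: int
  assumes "finite P" "odd D" "D > 0"
  shows "\<exists>M \<beta>. odd M \<and> M > 0 \<and> D dvd M \<and> [\<beta> = \<alpha>] (mod D) \<and>
    (\<forall>x p b n. [x = \<beta>] (mod M) \<longrightarrow> p \<in> P \<longrightarrow> x \<noteq> p\<^sup>2 + b\<^sup>2 + 2 ^ n)"
  using assms(1)
proof (induction P rule: finite_induct)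
  case empty
  show ?case using assms by (intro exI[of _ D] exI[of _ \<alpha>]) auto
next
  case (insert q P)
  then obtain M \<beta> where M: "odd M" "M > 0" "D dvd M" "[\<beta> = \<alpha>] (mod D)"
    and avoid: "\<And>x p b n. [x = \<beta>] (mod M) \<Longrightarrow> p \<in> P \<Longrightarrow> x \<noteq> p\<^sup>2 + b\<^sup>2 + 2 ^ n"
    by blast
  obtain r m where r: "prime r" "r mod 4 = 3" "coprime r (nat M)" "[2 * m\<^sup>2 = 1] (mod int r)"
    using ex_coprime_prime_3_mod_4[of "nat M"] M(2) by auto
  have "coprime M (int r)"
    using r(3) M(2) by (metis coprime_commute coprime_int_iff int_nat_eq less_imp_le)
  then obtain \<gamma> where \<gamma>: "[\<gamma> = \<beta>] (mod M)" "[\<gamma> = q\<^sup>2] (mod int r)"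
    using binary_chinese_remainder_int by blast
  have "x \<noteq> p\<^sup>2 + b\<^sup>2 + 2 ^ n"
    if x: "[x = \<gamma>] (mod M * int r)" and p: "p \<in> insert q P" for x p b n
  proof (cases "p = q")
    case True
    have "[x = q\<^sup>2] (mod int r)"
      using x \<gamma>(2) by (meson cong_modulus_mult cong_trans mult.commute cong_dvd_modulus dvd_triv_right)
    then have "int r dvd x - q\<^sup>2" by (simp add: cong_iff_dvd_diff)
    moreover have "\<not> int r dvd b\<^sup>2 + 2 ^ n"
      using not_dvd_square_plus_power_two r by blast
    ultimately show ?thesis using True by auto
  next
    case False
    have "[x = \<beta>] (mod M)" using x \<gamma>(1) by (meson cong_modulus_mult cong_trans)
    with avoid False p show ?thesis by blast
  qed
  moreover have "[\<gamma> = \<alpha>] (mod D)"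
    using \<gamma>(1) M(3,4) by (meson cong_dvd_modulus cong_trans)
  moreover have "odd (int r)" using r(2) by presburger
  moreover have "M * int r > 0" using M(2) r(1) prime_gt_0_nat by simp
  ultimately show ?case using M
    by (intro exI[of _ "M * int r"] exI[of _ \<gamma>]) auto
qed

section \<open>A covering system of the exponents\<close>

text \<open>
  An entry \<open>(a, m, q)\<close> stands for the class \<open>n \<equiv> a (mod m)\<close> and a divisor \<open>q \<equiv> 3 (mod 4)\<close> of
  \<open>2\<^sup>m - 1\<close>. No primality proof for \<open>q\<close> is needed: some prime factor of \<open>q\<close> is \<open>3 (mod 4)\<close>, and
  the \<open>q\<close> are pairwise coprime. The covering was found by computer search: the
  moduli \<open>m\<close> not divisible by 11 miss only the class \<open>n \<equiv> 253 (mod 630)\<close>.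
\<close>

definition covering :: "(int \<times> int \<times> int) list" where
  "covering =
     [(0, 2, 3), (0, 3, 7), (2, 5, 31), (5, 10, 11), (5, 7, 127), (3, 14, 43), (5, 18, 19),
      (0, 11, 23), (1, 22, 683), (1, 15, 151), (19, 30, 331), (23, 42, 5419), (29, 54, 87211),
      (13, 33, 599479), (25, 66, 67), (28, 35, 71), (53, 70, 86171), (44, 45, 631),
      (26, 45, 23311), (48, 55, 3191), (93, 110, 2971), (83, 110, 48912491), (73, 99, 199),
      (19, 99, 33057806959), (163, 198, 5347), (109, 198, 242099935645987), (13, 105, 29191),
      (163, 210, 211), (101, 135, 271), (209, 270, 811), (263, 270, 385838642647891),
      (11, 189, 1560007), (92, 189, 207617485544258392970753527), (119, 378, 379),
      (335, 378, 119827), (8, 315, 870031), (148, 315, 983431), (503, 630, 1765891),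
      (43, 630, 11247702599676505481447137991664348691)]"

text \<open>
  Testing all residues modulo 20790, the least common multiple of the moduli, would be slow, so a
  class is split (successively by the factors \<open>ks\<close>) only when no single entry covers it.
\<close>

fun covers :: "(int \<times> int \<times> int) list \<Rightarrow> int list \<Rightarrow> int \<Rightarrow> int \<Rightarrow> bool" where
  "covers C [] r M = list_ex (\<lambda>(a, m, q). M mod m = 0 \<and> r mod m = a) C"
| "covers C (k # ks) r M =
     (covers C [] r M \<or> k > 0 \<and> list_all (\<lambda>i. covers C ks (r + i * M) (M * k)) [0..k - 1])"

lemma covers_sound:
  assumes "covers C ks r M" "[n = r] (mod M)"
  shows "\<exists>(a, m, q)\<in>set C. n mod m = a"
  using assms
proof (induction ks arbitrary: r M)
  case Nil
  then obtain a m q where C: "(a, m, q) \<in> set C" "M mod m = 0" "r mod m = a"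
    by (auto simp: list_ex_iff)
  then have "n mod m = a"
    using Nil.prems(2) by (metis cong_def cong_dvd_modulus dvd_eq_mod_eq_0)
  with C(1) show ?case by blast
next
  case (Cons k ks)
  show ?case
  proof (cases "covers C [] r M")
    case True
    then obtain a m q where C: "(a, m, q) \<in> set C" "M mod m = 0" "r mod m = a"
      by (auto simp: list_ex_iff)
    then have "n mod m = a"
      using Cons.prems(2) by (metis cong_def cong_dvd_modulus dvd_eq_mod_eq_0)
    with C(1) show ?thesis by blast
  next
    case False
    with Cons.prems(1) have k: "k > 0"
      and all: "\<And>i. i \<in> {0..k - 1} \<Longrightarrow> covers C ks (r + i * M) (M * k)"
      by (auto simp: list_all_iff)
    from Cons.prems(2) obtain j where j: "n = r + M * j"
      by (metis cong_iff_lin cong_sym)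
    \<comment> \<open>The residue \<open>j mod k\<close> selects the subclass modulo
      \<open>M * k\<close> that contains \<open>n\<close>.\<close>
    have "n = r + (j mod k) * M + (M * k) * (j div k)"
      unfolding j by (metis (no_types) add.assoc distrib_left mod_mult_div_eq mult.assoc mult.commute)
    then have "[n = r + (j mod k) * M] (mod M * k)"
      by (simp add: cong_iff_dvd_diff)
    moreover have "j mod k \<in> {0..k - 1}" using k by simp
    ultimately show ?thesis using Cons.IH all by blast
  qed
qed

lemma covering_covers: "\<exists>(a, m, q)\<in>set covering. n mod m = a"
proof (rule covers_sound)
  \<comment> \<open>The factors multiply to 20790; 11 comes last because only the class missed by
    the moduli prime to 11 needs it.\<close>
  show "covers covering [2, 3, 5, 3, 7, 3, 11] 0 1" by code_simp
qed simp

lemma covering_moduli: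
  assumes "(a, m, q) \<in> set covering"
  shows "a \<ge> 0" "m > 0" "q > 0" "q mod 4 = 3" "[2 ^ nat m = 1] (mod q)"
proof -
  have "list_all (\<lambda>(a, m, q). a \<ge> 0 \<and> m > 0 \<and> q > 0 \<and> q mod 4 = 3 \<and> 2 ^ nat m mod q = 1 mod q) covering"
    by code_simp
  then have "a \<ge> 0 \<and> m > 0 \<and> q > 0 \<and> q mod 4 = 3 \<and> 2 ^ nat m mod q = 1 mod q"
    using assms unfolding list_all_iff by blast
  then show "a \<ge> 0" "m > 0" "q > 0" "q mod 4 = 3" "[2 ^ nat m = 1] (mod q)"
    unfolding cong_def by blast+
qed

lemma sorted_wrt_set_cases:
  assumes "sorted_wrt R xs" "x \<in> set xs" "y \<in> set xs"
  shows "x = y \<or> R x y \<or> R y x"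
  using assms by (induction xs) auto

lemma coprime_covering:
  assumes "(a, m, q) \<in> set covering" "(a', m', q') \<in> set covering" "(a, m, q) \<noteq> (a', m', q')"
  shows "coprime q q'"
proof -
  \<comment> \<open>\<open>sorted_wrt\<close> tests each pair in one order only, which is enough
    since the gcd is symmetric.\<close>
  have "sorted_wrt (\<lambda>(_, _, q) (_, _, q'). gcd q q' = 1) covering"
    by code_simp
  from sorted_wrt_set_cases[OF this assms(1,2)] assms(3) show ?thesis
    by (auto simp: coprime_iff_gcd_eq_1 gcd.commute)
qed

section \<open>From the covering to a class that forces \<open>p\<close> into a finite set\<close>

lemma cong_power_mod_period:
  fixes q :: int and n m :: nat
  assumes "[2 ^ m = 1] (mod q)"
  shows "[2 ^ n = 2 ^ (n mod m)] (mod q)"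
proof -
  have "[(2 ^ m) ^ (n div m) * 2 ^ (n mod m) = 1 ^ (n div m) * 2 ^ (n mod m)] (mod q)"
    using assms by (intro cong_mult cong_pow cong_refl)
  then show ?thesis
    by (simp flip: power_mult power_add)
qed

text \<open>\<open>P\<close> holds one prime \<open>\<pi> e\<close> for each entry \<open>e\<close>
  of the covering, and \<open>D\<close> is their product. If \<open>n\<close> lies in the class of
  \<open>e\<close>, then \<open>2 ^ n\<close> and \<alpha> agree modulo \<open>\<pi> e\<close>,
  which therefore divides p^2 + b^2 and equals \<open>p\<close>.\<close>

lemma ex_residue_class_forcing_prime:
  "\<exists>P D (\<alpha> :: int). finite P \<and> odd D \<and> D > 0 \<and>
    (\<forall>p b n :: nat. prime p \<longrightarrow> [int p ^ 2 + int b ^ 2 + 2 ^ n = \<alpha>] (mod D) \<longrightarrow> int p \<in> P)"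
proof -
  define \<pi> where "\<pi> e = (SOME q'. prime q' \<and> q' dvd nat (snd (snd e)) \<and> q' mod 4 = 3)"
    for e :: "int \<times> int \<times> int"
  have \<pi>: "prime (\<pi> e)" "\<pi> e dvd nat q" "\<pi> e mod 4 = 3"
    if e: "e \<in> set covering" "e = (a, m, q)" for e a m q
  proof -
    have "int (nat q mod 4) = 3"
      using covering_moduli(3,4)[of a m q] e by (simp add: zmod_int)
    then have "nat q mod 4 = 3" by linarith
    from someI_ex[OF ex_prime_factor_3_mod_4[OF this]]
    show "prime (\<pi> e)" "\<pi> e dvd nat q" "\<pi> e mod 4 = 3"
      unfolding \<pi>_def e(2) by auto
  qed
  have coprime_\<pi>: "coprime (\<pi> e) (\<pi> e')"
    if e: "e \<in> set covering" "e' \<in> set covering" "e \<noteq> e'" for e e'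
  proof -
    obtain a m q a' m' q' where eq: "e = (a, m, q)" "e' = (a', m', q')"
      by (metis prod_cases3)
    have "coprime q q'" "q > 0" "q' > 0"
      using coprime_covering covering_moduli(3) e unfolding eq by blast+
    then have "coprime (nat q) (nat q')" by (metis coprime_int_iff int_nat_eq less_imp_le)
    with \<pi>(2)[OF e(1) eq(1)] \<pi>(2)[OF e(2) eq(2)] show ?thesis
      by (rule coprime_divisors)
  qed
  have "\<exists>\<alpha>. \<forall>e\<in>set covering. [\<alpha> = 2 ^ nat (fst e)] (mod \<pi> e)"
    using coprime_\<pi> by (intro chinese_remainder_nat ballI impI) simp_all
  then obtain \<alpha> where \<alpha>: "\<And>e. e \<in> set covering \<Longrightarrow> [\<alpha> = 2 ^ nat (fst e)] (mod \<pi> e)"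
    by blast
  define D where "D = (\<Prod>e\<in>set covering. \<pi> e)"
  have "odd D"
  proof -
    have "odd (\<pi> e)" if e: "e \<in> set covering" for e
    proof -
      obtain a m q where "e = (a, m, q)" by (rule prod_cases3)
      from \<pi>(3)[OF e this] show ?thesis by presburger
    qed
    then show ?thesis unfolding D_def by (simp add: even_prod_iff)
  qed
  have "int p \<in> (int \<circ> \<pi>) ` set covering"
    if p: "prime p" and x: "[int p ^ 2 + int b ^ 2 + 2 ^ n = int \<alpha>] (mod int D)" for p b n :: nat
  proof -
    obtain a m q where e: "(a, m, q) \<in> set covering" (is "?e \<in> _") and nm: "int n mod m = a"
      using covering_covers[of "int n"] by blast
    note moduli = covering_moduli[OF e]
    have "n mod nat m = nat a"
      using nm moduli(1,2) by (metis int_nat_eq less_imp_le nat_int zmod_int)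
    then have "[2 ^ n = 2 ^ nat a] (mod q)"
      using cong_power_mod_period[OF moduli(5), of n] by simp
    moreover have "int (\<pi> ?e) dvd q"
      using \<pi>(2)[OF e refl] moduli(3) by (metis int_dvd_int_iff int_nat_eq less_imp_le)
    ultimately have pow: "[2 ^ n = 2 ^ nat a] (mod int (\<pi> ?e))"
      by (rule cong_dvd_modulus)
    have "\<pi> ?e dvd D" unfolding D_def using e by (intro dvd_prodI) auto
    then have "[int p ^ 2 + int b ^ 2 + 2 ^ n = int \<alpha>] (mod int (\<pi> ?e))"
      using x cong_dvd_modulus int_dvd_int_iff by blast
    also have "[int \<alpha> = 2 ^ nat a] (mod int (\<pi> ?e))"
      using \<alpha>[OF e] cong_int_iff[of \<alpha> "2 ^ nat a" "\<pi> ?e"] by simp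
    also have "[2 ^ nat a = 2 ^ n] (mod int (\<pi> ?e))"
      using pow by (rule cong_sym)
    finally have "int (\<pi> ?e) dvd int p ^ 2 + int b ^ 2"
      by (simp add: cong_iff_dvd_diff)
    then have "\<pi> ?e dvd p"
      using prime_3_mod_4_dvd_sum_squares \<pi>[OF e refl] int_dvd_int_iff by blast
    then have "p = \<pi> ?e"
      using p \<pi>(1)[OF e refl] primes_dvd_imp_eq by blast
    then show ?thesis using e by force
  qed
  moreover have "D > 0" using \<open>odd D\<close> by (cases "D = 0") auto
  ultimately show ?thesis using \<open>odd D\<close>
    by (intro exI[of _ "(int \<circ> \<pi>) ` set covering"] exI[of _ "int D"] exI[of _ "int \<alpha>"]) auto
qed

theorem theorem2:
  shows "\<exists>M \<alpha> :: int. odd M \<and> M > 0 \<and>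
    (\<forall>x \<in> {x :: int. [x = \<alpha>] (mod M)}.
       \<not> (\<exists>p b n :: nat. prime p \<and> x = int p ^ 2 + int b ^ 2 + 2 ^ n))"
proof -
  obtain P D and \<alpha> :: int where P: "finite P" "odd D" "D > 0"
    and mem: "\<And>p b n :: nat. prime p \<Longrightarrow>
      [int p ^ 2 + int b ^ 2 + 2 ^ n = \<alpha>] (mod D) \<Longrightarrow> int p \<in> P"
    using ex_residue_class_forcing_prime by blast
  \<comment> \<open>The refined class lies inside the class of \<alpha> modulo \<open>D\<close>, so
    it still forces \<open>p\<close> into \<open>P\<close> while excluding every member of
    \<open>P\<close>.\<close>
  obtain M \<beta> where M: "odd M" "M > 0" "D dvd M" "[\<beta> = \<alpha>] (mod D)"
    and avoid: "\<And>x p b n. [x = \<beta>] (mod M) \<Longrightarrow> p \<in> P \<Longrightarrow> x \<noteq> p\<^sup>2 + b\<^sup>2 + 2 ^ n"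
    using ex_residue_class_avoiding_squares[OF P] by blast
  have "\<not> (\<exists>p b n :: nat. prime p \<and> x = int p ^ 2 + int b ^ 2 + 2 ^ n)"
    if x: "[x = \<beta>] (mod M)" for x
  proof
    assume "\<exists>p b n :: nat. prime p \<and> x = int p ^ 2 + int b ^ 2 + 2 ^ n"
    then obtain p b n :: nat where p: "prime p" and eq: "x = int p ^ 2 + int b ^ 2 + 2 ^ n"
      by blast
    have "[x = \<alpha>] (mod D)" using x M(3,4) by (meson cong_dvd_modulus cong_trans)
    then have "int p \<in> P" using mem p eq by blast
    then show False using avoid x eq by blast
  qed
  with M(1,2) show ?thesis by blast
qed

end
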